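(* Let $\mathcal{L}:\mathbb{R}^{d_x}\times\mathbb{R}^{d_y}\to\mathbb{R}$ be differentiable, let $\mathcal{X}\subset\mathbb{R}^{d_x}$ and $\mathcal{Y}\subset\mathbb{R}^{d_y}$ be closed sets, let $(x_0,y_0)\in\mathcal{X}\times\mathcal{Y}$, $\rho_x,\rho_y>0$, $\mathcal{X}_0=\mathcal{X}\cap\mathbb{B}_2(x_0,\rho_x)$, $\mathcal{Y}_0=\mathcal{Y}\cap\mathbb{B}_2(y_0,\rho_y)$, and let $(\widehat{x},\widehat{y})=\arg\min\{\mathcal{L}(x,y):x\in\mathcal{X}_0,y\in\mathcal{Y}_0\}$. Suppose that there are constants $0<\alpha_x\le\beta_x$, $0<\alpha_y\le\beta_y$, $0\le\mu_x\le\alpha_x$, $0\le\mu_y\le\alpha_y$, $\epsilon_x,\epsilon_y\ge 0$ such that the following four assumptions (stated in full in the context) hold: joint restricted strong convexity, restricted smoothness, the cross-product bound, and the initialization condition. Let, for $t\ge 1$, $$x_t=\arg\min_{x\in\mathcal{X}_0}\mathcal{L}(x,y_{t-1}),\qquad y_t=\arg\min_{y\in\mathcal{Y}_0}\mathcal{L}(x_t,y).$$ Then for all $t\ge1$, $$D(x_t;\widehat{x})\le\sqrt{1-\frac{\alpha_y}{2\beta_y}}\cdot D(y_{t-1};\widehat{y})+\sqrt{3(\alpha_x\epsilon_x^2+\alpha_y\epsilon_y^2)},$$ $$D(y_t;\widehat{y})\le\sqrt{1-\frac{\alpha_x}{2\beta_x}}\cdot D(x_t;\widehat{x})+\sqrt{3(\alpha_x\epsilon_x^2+\alpha_y\epsilon_y^2)}.$$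 In particular, for all $t\ge 1$, $$\|(x_t,y_t)-(\widehat{x},\widehat{y})\|_2\le\left(\sqrt{1-\frac{\alpha_x}{2\beta_x}}\cdot\sqrt{1-\frac{\alpha_y}{2\beta_y}}\right)^t\cdot\frac{\sqrt{6\beta_y}\,\rho_y}{\sqrt{\min\{\alpha_x,\alpha_y\}}}+C\cdot\max\{\epsilon_x,\epsilon_y\},$$ where $$C=\frac{18}{1-\sqrt{1-\frac{\alpha_x}{2\beta_x}}\cdot\sqrt{1-\frac{\alpha_y}{2\beta_y}}}\cdot\sqrt{\frac{\max\{\alpha_x,\alpha_y\}}{\min\{\alpha_x,\alpha_y\}}}.$$
   Context: **Notation.** $\mathbb{B}_2(z,\rho)$ is the closed Euclidean ball of center $z$ and radius $\rho$. All argmins are assumed to exist; if an argmin is not unique, it denotes a chosen minimizer (the same choice in the algorithm and in the initialization condition). $\|\cdot\|_x$ and $\|\cdot\|_y$ are fixed norms on $\mathbb{R}^{d_x}$ and $\mathbb{R}^{d_y}$ satisfying $\|\cdot\|_x\ge\|\cdot\|_2$, $\|\cdot\|_y\ge\|\cdot\|_2$; $\|\cdot\|_x^*$, $\|\cdot\|_y^*$ are their dual norms. **Local concavity coefficients.** Let $\mathcal{Z}\subset\mathbb{R}^d$ be closed and $\|\cdot\|$ a norm on $\mathbb{R}^d$. $\mathcal{Z}$ satisfies the curvature condition at $z\in\mathcal{Z}$ with parameter $\gamma_z\in[0,\infty]$ if for all $z'\in\mathcal{Z}$, $\limsup_{t\to0^+}\frac{\min_{w\in\mathcal{Z}}\|w-((1-t)z+tz')\|}{t}\le\gamma_z\|z-z'\|_2^2$.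 A point $z\in\mathcal{Z}$ is degenerate if the Euclidean projection $\mathcal{P}_{\mathcal{Z}}$ onto $\mathcal{Z}$ is not continuous in any neighborhood of $z$. The local concavity coefficient $\gamma_z(\mathcal{Z})$ is $\infty$ if $z$ is degenerate, and otherwise the smallest $\gamma_z\in[0,\infty]$ such that the curvature condition holds at $z$. The global coefficient is $\gamma(\mathcal{Z})=\sup_{z\in\mathcal{Z}}\gamma_z(\mathcal{Z})$. Here $\gamma(\mathcal{X}_0)$ is taken with respect to $\|\cdot\|_x$ and $\gamma(\mathcal{Y}_0)$ with respect to $\|\cdot\|_y$. **First-order divergence.** $D^2(x;\widehat{x})=\langle x-\widehat{x},\nabla_x\mathcal{L}(x,\widehat{y})-\nabla_x\mathcal{L}(\widehat{x},\widehat{y})\rangle$ and $D^2(y;\widehat{y})=\langle y-\widehat{y},\nabla_y\mathcal{L}(\widehat{x},y)-\nabla_y\mathcal{L}(\widehat{x},\widehat{y})\rangle$ (these may be negative); $D(x;\widehat{x})=\sqrt{\max\{0,D^2(x;\widehat{x})\}}$, $D(y;\widehat{y})=\sqrt{\max\{0,D^2(y;\widehat{y})\}}$. **Joint restricted strong convexity.** For all $x\in\mathcal{X}_0$, $y\in\mathcal{Y}_0$: $\left\langle\begin{pmatrix}x-\widehat{x}\\ y-\widehat{y}\end{pmatrix},\nabla\mathcal{L}(x,y)-\nabla\mathcal{L}(\widehat{x},\widehat{y})\right\rangle\ge\alpha_x\|x-\widehat{x}\|_2^2+\alpha_y\|y-\widehat{y}\|_2^2-\alpha_x\epsilon_x^2-\alpha_y\epsilon_y^2$.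 **Restricted smoothness.** For all $x\in\mathcal{X}_0$, $y\in\mathcal{Y}_0$: $D^2(x;\widehat{x})\le\beta_x\|x-\widehat{x}\|_2^2+\alpha_x\epsilon_x^2$ and $D^2(y;\widehat{y})\le\beta_y\|y-\widehat{y}\|_2^2+\alpha_y\epsilon_y^2$. **Cross-product bound.** For all $x\in\mathcal{X}_0$, $y\in\mathcal{Y}_0$: $\left|\langle x-\widehat{x},\nabla_x\mathcal{L}(x,y)-\nabla_x\mathcal{L}(x,\widehat{y})\rangle-\langle y-\widehat{y},\nabla_y\mathcal{L}(x,y)-\nabla_y\mathcal{L}(\widehat{x},y)\rangle\right|\le\frac12\mu_x\|x-\widehat{x}\|_2^2+\frac12\mu_y\|y-\widehat{y}\|_2^2+\alpha_x\epsilon_x^2+\alpha_y\epsilon_y^2$. **Initialization condition.** With $x_y=\arg\min\{\mathcal{L}(x,y):x\in\mathcal{X}_0\}$ for $y\in\mathcal{Y}_0$ and $y_x=\arg\min\{\mathcal{L}(x,y):y\in\mathcal{Y}_0\}$ for $x\in\mathcal{X}_0$: $2\gamma(\mathcal{X}_0)\left(\|\nabla_x\mathcal{L}(\widehat{x},\widehat{y})\|_x^*+\max_{y\in\mathcal{Y}_0}\|\nabla_x\mathcal{L}(x_y,y)\|_x^*\right)\le\alpha_x-\mu_x$ and $2\gamma(\mathcal{Y}_0)\left(\|\nabla_y\mathcal{L}(\widehat{x},\widehat{y})\|_y^*+\max_{x\in\mathcal{X}_0}\|\nabla_y\mathcal{L}(x,y_x)\|_y^*\right)\le\alpha_y-\mu_y$.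 *)

theory Defs
  imports "HOL-Analysis.Analysis"
begin

section \<open>Gradients\<close>

definition gradient :: "('a::real_inner \<Rightarrow> real) \<Rightarrow> 'a \<Rightarrow> 'a" where
  "gradient f z = (THE g. GDERIV f z :> g)"

definition gradient_x :: "('a::real_inner \<times> 'b::real_inner \<Rightarrow> real) \<Rightarrow> 'a \<Rightarrow> 'b \<Rightarrow> 'a" where
  "gradient_x L x y = gradient (\<lambda>u. L (u, y)) x"

definition gradient_y :: "('a::real_inner \<times> 'b::real_inner \<Rightarrow> real) \<Rightarrow> 'a \<Rightarrow> 'b \<Rightarrow> 'b" where
  "gradient_y L x y = gradient (\<lambda>v. L (x, v)) y"

lemma gradient_eqI:
  assumes "GDERIV f z :> g"
  shows "gradient f z = g"
  unfolding gradient_def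
proof (rule the_equality)
  fix h assume "GDERIV f z :> h"
  then have "(\<lambda>v. v \<bullet> h) = (\<lambda>v. v \<bullet> g)"
    using assms unfolding gderiv_def by (rule has_derivative_unique)
  then have "(h - g) \<bullet> h = (h - g) \<bullet> g" by (rule fun_cong)
  then have "(h - g) \<bullet> (h - g) = 0" by (simp add: inner_diff_right)
  then show "h = g" by simp
qed (fact assms)

section \<open>Norms other than the Euclidean one\<close>

definition is_norm :: "('a::real_vector \<Rightarrow> real) \<Rightarrow> bool" where
  "is_norm N \<longleftrightarrow> (\<forall>v. 0 \<le> N v) \<and> (\<forall>v. N v = 0 \<longleftrightarrow> v = 0) \<and>
     (\<forall>c v. N (c *\<^sub>R v) = \<bar>c\<bar> * N v) \<and> (\<forall>v w. N (v + w) \<le> N v + N w)"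

definition dual_norm :: "('a::real_inner \<Rightarrow> real) \<Rightarrow> 'a \<Rightarrow> real" where
  "dual_norm N g = (SUP v\<in>{v. N v \<le> 1}. g \<bullet> v)"

section \<open>Concavity coefficients\<close>

text \<open>The real infimum below is the minimum over \<open>Z\<close>: it is attained for closed nonempty \<open>Z\<close> in
  finite dimension. In \<^typ>\<open>ennreal\<close>, \<open>\<infinity> * 0 = 0\<close>, which matters only for \<open>z' = z\<close>, where the
  left-hand side is 0.\<close>

definition curvature_condition ::
    "('a::real_normed_vector \<Rightarrow> real) \<Rightarrow> 'a set \<Rightarrow> 'a \<Rightarrow> ennreal \<Rightarrow> bool" where
  "curvature_condition N Z z \<gamma> \<longleftrightarrow>
     (\<forall>z'\<in>Z. Limsup (at_right 0)
         (\<lambda>t::real. ennreal ((INF w\<in>Z. N (w - ((1 - t) *\<^sub>R z + t *\<^sub>R z'))) / t))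
       \<le> \<gamma> * ennreal ((norm (z - z'))\<^sup>2))"

text \<open>\<^const>\<open>closest_point\<close> is an arbitrary selection where the nearest point is not unique. The choice
  is immaterial: if \<open>q\<close> is nearest to \<open>p\<close>, then \<open>q\<close> is the only nearest point of the other points
  of the segment from \<open>p\<close> to \<open>q\<close>, so a selection that is continuous at \<open>p\<close> has the value \<open>q\<close> there.\<close>

definition degenerate_point :: "'a::euclidean_space set \<Rightarrow> 'a \<Rightarrow> bool" where
  "degenerate_point Z z \<longleftrightarrow>
     \<not> (\<exists>U. open U \<and> z \<in> U \<and> continuous_on U (closest_point Z))"

definition local_concavity :: "('a::euclidean_space \<Rightarrow> real) \<Rightarrow> 'a set \<Rightarrow> 'a \<Rightarrow> ennreal" where
  "local_concavity N Z z =
     (if degenerate_point Z z then \<infinity> else (LEAST \<gamma>. curvature_condition N Z z \<gamma>))"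

definition global_concavity :: "('a::euclidean_space \<Rightarrow> real) \<Rightarrow> 'a set \<Rightarrow> ennreal" where
  "global_concavity N Z = (SUP z\<in>Z. local_concavity N Z z)"

lemma curvature_condition_Least:
  assumes N: "is_norm N" and z: "z \<in> Z"
  shows "curvature_condition N Z z (LEAST \<gamma>. curvature_condition N Z z \<gamma>)"
proof -
  let ?F = "\<lambda>z'. Limsup (at_right 0)
    (\<lambda>t::real. ennreal ((INF w\<in>Z. N (w - ((1 - t) *\<^sub>R z + t *\<^sub>R z'))) / t))"
  let ?c = "\<lambda>z'. ennreal ((norm (z - z'))\<^sup>2)"
  let ?m = "SUP z'\<in>Z - {z}. ?F z' / ?c z'"
  have c: "?c z' \<noteq> 0" "?c z' \<noteq> \<infinity>" if "z' \<noteq> z" for z'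
    using that by (auto simp: ennreal_eq_0_iff)
  have inf0: "(INF w\<in>Z. N (w - ((1 - t) *\<^sub>R z + t *\<^sub>R z))) = 0" for t
  proof -
    have p: "(1 - t) *\<^sub>R z + t *\<^sub>R z = z" by (simp add: scaleR_left_diff_distrib)
    have "Inf ((\<lambda>w. N (w - z)) ` Z) = 0"
      by (rule cInf_eq_minimum) (use N z in \<open>auto simp: is_norm_def image_iff intro!: bexI[of _ z]\<close>)
    then show ?thesis by (simp only: p)
  qed
  have F0: "?F z = 0"
    unfolding inf0 by (simp add: Limsup_const)
  have iff: "curvature_condition N Z z \<gamma> \<longleftrightarrow> ?m \<le> \<gamma>" for \<gamma>
  proof
    assume *: "curvature_condition N Z z \<gamma>"
    show "?m \<le> \<gamma>"
    proof (rule SUP_least)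
      fix z' assume z': "z' \<in> Z - {z}"
      then have "?F z' \<le> \<gamma> * ?c z'" using * by (auto simp: curvature_condition_def)
      then have "?F z' / ?c z' \<le> \<gamma> * ?c z' / ?c z'" by (rule divide_right_mono_ennreal)
      also have "\<dots> = \<gamma>" using c[of z'] z'
        by (intro ennreal_mult_divide_eq) auto
      finally show "?F z' / ?c z' \<le> \<gamma>" .
    qed
  next
    assume *: "?m \<le> \<gamma>"
    show "curvature_condition N Z z \<gamma>"
      unfolding curvature_condition_def
    proof
      fix z' assume z': "z' \<in> Z"
      show "?F z' \<le> \<gamma> * ?c z'"
      proof (cases "z' = z")
        case True
        then show ?thesis using F0 by simp
      next
        case False
        have "?F z' / ?c z' \<le> ?m" by (rule SUP_upper) (use z' False in auto)
        then have "?F z' / ?c z' \<le> \<gamma>" using * by (rule order_trans)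
        then have "?F z' / ?c z' * ?c z' \<le> \<gamma> * ?c z'" by (rule mult_right_mono) simp
        moreover have "?F z' / ?c z' * ?c z' = ?F z'"
          using ennreal_mult_divide_eq[of "?c z'" "?F z'"] c[OF False]
          unfolding infinity_ennreal_def mult.commute[of _ "?c z'"] ennreal_times_divide
          by simp
        ultimately show ?thesis by simp
      qed
    qed
  qed
  show ?thesis
    unfolding iff by (rule LeastI2_order[of _ ?m]) auto
qed

section \<open>Divergences and the assumptions on the loss\<close>

definition D2_x where
  "D2_x L xh yh x = (x - xh) \<bullet> (gradient_x L x yh - gradient_x L xh yh)"

definition D2_y where
  "D2_y L xh yh y = (y - yh) \<bullet> (gradient_y L xh y - gradient_y L xh yh)"

definition D_x where
  "D_x L xh yh x = sqrt (max 0 (D2_x L xh yh x))"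

definition D_y where
  "D_y L xh yh y = sqrt (max 0 (D2_y L xh yh y))"

definition joint_RSC where
  "joint_RSC L X0 Y0 xh yh \<alpha>x \<alpha>y \<epsilon>x \<epsilon>y \<longleftrightarrow>
     (\<forall>x\<in>X0. \<forall>y\<in>Y0.
        ((x, y) - (xh, yh)) \<bullet> (gradient L (x, y) - gradient L (xh, yh))
        \<ge> \<alpha>x * (norm (x - xh))\<^sup>2 + \<alpha>y * (norm (y - yh))\<^sup>2 - \<alpha>x * \<epsilon>x\<^sup>2 - \<alpha>y * \<epsilon>y\<^sup>2)"

definition restricted_smoothness where
  "restricted_smoothness L X0 Y0 xh yh \<alpha>x \<alpha>y \<beta>x \<beta>y \<epsilon>x \<epsilon>y \<longleftrightarrow>
     (\<forall>x\<in>X0. \<forall>y\<in>Y0.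
        D2_x L xh yh x \<le> \<beta>x * (norm (x - xh))\<^sup>2 + \<alpha>x * \<epsilon>x\<^sup>2 \<and>
        D2_y L xh yh y \<le> \<beta>y * (norm (y - yh))\<^sup>2 + \<alpha>y * \<epsilon>y\<^sup>2)"

definition cross_product_bound where
  "cross_product_bound L X0 Y0 xh yh \<alpha>x \<alpha>y \<mu>x \<mu>y \<epsilon>x \<epsilon>y \<longleftrightarrow>
     (\<forall>x\<in>X0. \<forall>y\<in>Y0.
        \<bar>(x - xh) \<bullet> (gradient_x L x y - gradient_x L x yh)
          - (y - yh) \<bullet> (gradient_y L x y - gradient_y L xh y)\<bar>
        \<le> 1/2 * \<mu>x * (norm (x - xh))\<^sup>2 + 1/2 * \<mu>y * (norm (y - yh))\<^sup>2
          + \<alpha>x * \<epsilon>x\<^sup>2 + \<alpha>y * \<epsilon>y\<^sup>2)"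

text \<open>\<open>xmin y\<close> and \<open>ymin x\<close> stand for the chosen minimizers \<open>x\<^sub>y\<close> and \<open>y\<^sub>x\<close>. Both sides are in
  \<^typ>\<open>ennreal\<close>, since the concavity coefficients may be infinite; \<open>\<infinity> * 0 = 0\<close>.\<close>

definition initialization_condition where
  "initialization_condition L Nx Ny X0 Y0 xh yh xmin ymin \<alpha>x \<alpha>y \<mu>x \<mu>y \<longleftrightarrow>
     2 * global_concavity Nx X0 *
       (ennreal (dual_norm Nx (gradient_x L xh yh))
        + (SUP y\<in>Y0. ennreal (dual_norm Nx (gradient_x L (xmin y) y)))) \<le> ennreal (\<alpha>x - \<mu>x) \<and>
     2 * global_concavity Ny Y0 *
       (ennreal (dual_norm Ny (gradient_y L xh yh))
        + (SUP x\<in>X0. ennreal (dual_norm Ny (gradient_y L x (ymin x))))) \<le> ennreal (\<alpha>y - \<mu>y)"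

end

(* At a minimizer z of f over Z with concavity coefficient \<gamma>, following a path in Z that stays close
   to the segment from z to z' gives the approximate first-order condition
   <z' - z, grad f z> >= - \<gamma> ||grad f z||* ||z' - z||^2.
   Adding this condition at xh and at x_t, the initialization condition bounds
   <x_t - xh, grad_x L(x_t, y) - grad_x L(xh, yh)> by (\<alpha>x - \<mu>x) / 2 ||x_t - xh||^2.
   Both gradient differences in the joint strong convexity inequality split into a divergence
   and a cross term, and the two cross terms nearly agree; eliminating them yields
   D^2(x_t) <= D^2(y_{t-1}) - \<alpha>y / 2 ||y_{t-1} - yh||^2 + O(\<epsilon>^2),
   and smoothness turns the negative term into a contraction. *)

theory Submission
  imports Defs
begin

section \<open>Gradients and dual norms\<close>

lemma GDERIV_exists:
  fixes f :: "'a::euclidean_space \<Rightarrow> real"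
  assumes "f differentiable (at z)"
  obtains g where "GDERIV f z :> g"
proof -
  obtain f' where f': "(f has_derivative f') (at z)"
    using assms by (auto simp: differentiable_def)
  then have lin: "linear f'" by (rule has_derivative_linear)
  have "f' = (\<lambda>v. v \<bullet> (\<Sum>b\<in>Basis. f' b *\<^sub>R b))"
  proof
    fix v
    have "f' v = f' (\<Sum>b\<in>Basis. (v \<bullet> b) *\<^sub>R b)" by (simp add: euclidean_representation)
    also have "\<dots> = (\<Sum>b\<in>Basis. (v \<bullet> b) * f' b)"
      by (simp add: linear_sum[OF lin] linear_scale[OF lin])
    also have "\<dots> = v \<bullet> (\<Sum>b\<in>Basis. f' b *\<^sub>R b)"
      by (simp add: inner_sum_right mult.commute)
    finally show "f' v = v \<bullet> (\<Sum>b\<in>Basis. f' b *\<^sub>R b)" .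
  qed
  then have "GDERIV f z :> (\<Sum>b\<in>Basis. f' b *\<^sub>R b)"
    using f' unfolding gderiv_def by simp
  then show thesis by (rule that)
qed

lemma
  fixes L :: "'a::real_inner \<times> 'b::real_inner \<Rightarrow> real"
  assumes "GDERIV L (u, v) :> (g, h)"
  shows GDERIV_partial_fst: "GDERIV (\<lambda>u. L (u, v)) u :> g"
    and GDERIV_partial_snd: "GDERIV (\<lambda>v. L (u, v)) v :> h"
proof -
  have L: "(L has_derivative (\<lambda>w. w \<bullet> (g, h))) (at (u, v))"
    using assms by (simp add: gderiv_def)
  have "((\<lambda>u. L (u, v)) has_derivative (\<lambda>w. (w, 0) \<bullet> (g, h))) (at u)"
    by (rule has_derivative_compose[where f = "\<lambda>u. (u, v)", OF _ L])
      (auto intro!: derivative_eq_intros)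
  then show "GDERIV (\<lambda>u. L (u, v)) u :> g" by (simp add: gderiv_def)
  have "((\<lambda>v. L (u, v)) has_derivative (\<lambda>w. (0, w) \<bullet> (g, h))) (at v)"
    by (rule has_derivative_compose[where f = "\<lambda>v. (u, v)", OF _ L])
      (auto intro!: derivative_eq_intros)
  then show "GDERIV (\<lambda>v. L (u, v)) v :> h" by (simp add: gderiv_def)
qed

lemma
  fixes L :: "'a::euclidean_space \<times> 'b::euclidean_space \<Rightarrow> real"
  assumes "L differentiable (at (u, v))"
  shows GDERIV_gradient_x: "GDERIV (\<lambda>u. L (u, v)) u :> gradient_x L u v"
    and GDERIV_gradient_y: "GDERIV (\<lambda>v. L (u, v)) v :> gradient_y L u v"
    and gradient_Pair: "gradient L (u, v) = (gradient_x L u v, gradient_y L u v)"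
proof -
  obtain g h where gh: "GDERIV L (u, v) :> (g, h)"
    using GDERIV_exists[OF assms] by (metis surj_pair)
  have x: "gradient_x L u v = g"
    unfolding gradient_x_def by (rule gradient_eqI[OF GDERIV_partial_fst[OF gh]])
  have y: "gradient_y L u v = h"
    unfolding gradient_y_def by (rule gradient_eqI[OF GDERIV_partial_snd[OF gh]])
  show "GDERIV (\<lambda>u. L (u, v)) u :> gradient_x L u v"
    unfolding x by (rule GDERIV_partial_fst[OF gh])
  show "GDERIV (\<lambda>v. L (u, v)) v :> gradient_y L u v"
    unfolding y by (rule GDERIV_partial_snd[OF gh])
  show "gradient L (u, v) = (gradient_x L u v, gradient_y L u v)"
    unfolding x y by (rule gradient_eqI[OF gh])
qed

lemma
  fixes N :: "'a::real_inner \<Rightarrow> real"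
  assumes N: "is_norm N" and le: "\<And>v. norm v \<le> N v"
  shows dual_norm_nonneg: "0 \<le> dual_norm N g"
    and inner_le_dual_norm: "g \<bullet> v \<le> dual_norm N g * N v"
proof -
  have N0: "N 0 = 0" using N unfolding is_norm_def by blast
  \<comment> \<open>A real supremum is informative only over a set bounded above. By
    \<open>norm v \<le> N v\<close> the unit ball of \<open>N\<close> lies in the Euclidean one,
    where Cauchy-Schwarz gives the bound.\<close>
  have bdd: "bdd_above ((\<lambda>v. g \<bullet> v) ` {v. N v \<le> 1})"
  proof (rule bdd_aboveI2)
    fix v assume "v \<in> {v. N v \<le> 1}"
    then have "norm v \<le> 1" using le[of v] by simp
    then have "norm g * norm v \<le> norm g * 1" by (intro mult_left_mono) auto
    then show "g \<bullet> v \<le> norm g" using norm_cauchy_schwarz[of g v] by simp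
  qed
  have upper: "g \<bullet> v \<le> dual_norm N g" if "N v \<le> 1" for v
    unfolding dual_norm_def by (rule cSUP_upper[OF _ bdd]) (use that in simp)
  show "0 \<le> dual_norm N g"
    using upper[of 0] N0 by simp
  show "g \<bullet> v \<le> dual_norm N g * N v"
  proof (cases "v = 0")
    case True
    then show ?thesis using N0 by simp
  next
    case False
    then have pos: "N v > 0" using N by (metis is_norm_def less_eq_real_def)
    have "N (inverse (N v) *\<^sub>R v) = \<bar>inverse (N v)\<bar> * N v"
      using N unfolding is_norm_def by blast
    then have "N (inverse (N v) *\<^sub>R v) = 1" using pos by simp
    then have "g \<bullet> (inverse (N v) *\<^sub>R v) \<le> dual_norm N g" by (intro upper) simp
    then show ?thesis using pos by (simp add: field_simps)
  qed
qed

text \<open>Serves the case of an infinite concavity coefficient, where the initialization condition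
  only says that dual norms vanish. Testing the dual bound with \<open>v = g\<close> gives
  \<open>g \<bullet> g \<le> 0\<close>.\<close>

lemma dual_norm_eq_0D:
  assumes "is_norm N" "\<And>v. norm v \<le> N v" "dual_norm N g = 0"
  shows "g = 0"
  using inner_le_dual_norm[OF assms(1,2), of g g] assms(3) inner_ge_zero[of g] by simp

section \<open>First-order optimality on nonconvex sets\<close>

text \<open>The segment from \<open>z\<close> to \<open>z'\<close> may leave \<open>Z\<close>, but
  for small \<open>t\<close> its point \<open>p\<close> at time \<open>t\<close> has some
  \<open>w\<close> in \<open>Z\<close> at \<open>N\<close>-distance of order
  \<open>t * \<gamma> * (norm (z' - z))\<^sup>2\<close>. Minimality against \<open>w\<close> is
  expanded to first order. The detour \<open>w - p\<close> costs at most its \<open>N\<close>-length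
  times the dual norm of \<open>g\<close>, and division by \<open>t\<close> leaves the
  claim.\<close>

lemma first_order_curvature:
  fixes f :: "'a::real_inner \<Rightarrow> real"
  assumes N: "is_norm N" and le: "\<And>v. norm v \<le> N v"
    and min: "\<And>w. w \<in> Z \<Longrightarrow> f z \<le> f w"
    and g: "GDERIV f z :> g"
    and curv: "curvature_condition N Z z (ennreal \<gamma>)" and \<gamma>: "0 \<le> \<gamma>"
    and z': "z' \<in> Z"
  shows "0 \<le> (z' - z) \<bullet> g + \<gamma> * dual_norm N g * (norm (z' - z))\<^sup>2"
proof -
  define K where "K = norm (z' - z)"
  define G where "G = dual_norm N g"
  have K: "0 \<le> K" by (simp add: K_def)
  have G: "0 \<le> G" unfolding G_def by (rule dual_norm_nonneg[OF N le])
  \<comment> \<open>The one slack \<open>e\<close> plays two parts: the excess of \<open>c\<close>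
    over the curvature rate, and the relative error in the linearization of \<open>f\<close> at
    \<open>z\<close>.\<close>
  have key: "0 \<le> (z' - z) \<bullet> g + G * (\<gamma> * K\<^sup>2 + e) + e * (K + (\<gamma> * K\<^sup>2 + e))" if e: "e > 0" for e
  proof -
    define c where "c = \<gamma> * K\<^sup>2 + e"
    have c: "0 < c" using \<gamma> e by (simp add: c_def add_nonneg_pos)
    have "Limsup (at_right 0)
        (\<lambda>t::real. ennreal ((INF w\<in>Z. N (w - ((1 - t) *\<^sub>R z + t *\<^sub>R z'))) / t))
        \<le> ennreal \<gamma> * ennreal ((norm (z - z'))\<^sup>2)"
      using curv z' by (simp add: curvature_condition_def)
    also have "\<dots> = ennreal (\<gamma> * K\<^sup>2)"
      using \<gamma> by (simp add: K_def norm_minus_commute ennreal_mult)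
    also have "\<dots> < ennreal c"
      using \<gamma> e by (subst ennreal_less_iff) (auto simp: c_def)
    finally have ev: "eventually (\<lambda>t::real.
        ennreal ((INF w\<in>Z. N (w - ((1 - t) *\<^sub>R z + t *\<^sub>R z'))) / t) < ennreal c) (at_right 0)"
      by (rule Limsup_lessD)
    obtain d where d: "d > 0"
      and der: "\<And>w. norm (w - z) < d \<Longrightarrow> \<bar>f w - f z - (w - z) \<bullet> g\<bar> \<le> e * norm (w - z)"
      using g e unfolding gderiv_def has_derivative_at_alt by auto
    \<comment> \<open>Below this threshold the point \<open>w\<close> chosen later stays within
      \<open>d\<close> of \<open>z\<close>, because
      \<open>norm (w - z) \<le> t * (K + c)\<close>.\<close>
    have "0 < d / (K + c)" using K c d by simp
    then have "eventually (\<lambda>t. t \<in> {0<..<d / (K + c)}) (at_right 0)"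
      by (rule eventually_at_right_real)
    from eventually_happens[OF eventually_conj[OF ev this]]
    obtain t where t: "0 < t" "t < d / (K + c)"
      and inf: "ennreal ((INF w\<in>Z. N (w - ((1 - t) *\<^sub>R z + t *\<^sub>R z'))) / t) < ennreal c"
      by auto
    define p where "p = (1 - t) *\<^sub>R z + t *\<^sub>R z'"
    have "(INF w\<in>Z. N (w - p)) / t < c"
      using inf c unfolding p_def[symmetric]
      by (meson ennreal_leI leD not_le_imp_less)
    then have "(INF w\<in>Z. N (w - p)) < t * c" using t by (simp add: field_simps)
    then obtain w where w: "w \<in> Z" "N (w - p) < t * c"
      using z' by (subst (asm) cInf_less_iff) (auto intro!: bdd_belowI2[of _ 0] simp: N[unfolded is_norm_def])
    have wz: "w - z = (w - p) + t *\<^sub>R (z' - z)"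
      by (simp add: p_def algebra_simps)
    have "norm (w - z) \<le> norm (w - p) + t * K"
      unfolding wz K_def using norm_triangle_ineq[of "w - p" "t *\<^sub>R (z' - z)"] t by simp
    also have "\<dots> \<le> t * c + t * K" using le[of "w - p"] w by simp
    finally have nwz: "norm (w - z) \<le> t * (K + c)" by (simp add: algebra_simps)
    also have "\<dots> < d" using t K c by (simp add: field_simps)
    finally have "\<bar>f w - f z - (w - z) \<bullet> g\<bar> \<le> e * norm (w - z)" by (rule der)
    also have "\<dots> \<le> e * (t * (K + c))" using nwz e by simp
    finally have "0 \<le> (w - z) \<bullet> g + e * (t * (K + c))" using min[OF w(1)] by linarith
    moreover have "(w - z) \<bullet> g = (w - p) \<bullet> g + t * ((z' - z) \<bullet> g)"
      unfolding wz by (simp add: inner_add_left)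
    moreover have "(w - p) \<bullet> g \<le> G * (t * c)"
    proof -
      have "(w - p) \<bullet> g \<le> G * N (w - p)"
        unfolding G_def using inner_le_dual_norm[OF N le, of g "w - p"] by (simp add: inner_commute)
      also have "\<dots> \<le> G * (t * c)" using w G by (intro mult_left_mono) auto
      finally show ?thesis .
    qed
    ultimately have "0 \<le> t * ((z' - z) \<bullet> g + G * c + e * (K + c))"
      by (simp add: algebra_simps)
    then show ?thesis using t by (simp add: zero_le_mult_iff c_def)
  qed
  have "((\<lambda>e. (z' - z) \<bullet> g + G * (\<gamma> * K\<^sup>2 + e) + e * (K + (\<gamma> * K\<^sup>2 + e))) \<longlongrightarrow>
      (z' - z) \<bullet> g + G * (\<gamma> * K\<^sup>2 + 0) + 0 * (K + (\<gamma> * K\<^sup>2 + 0))) (at_right 0)"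
    by (intro tendsto_intros)
  moreover have "eventually (\<lambda>e. 0 \<le> (z' - z) \<bullet> g + G * (\<gamma> * K\<^sup>2 + e) + e * (K + (\<gamma> * K\<^sup>2 + e)))
      (at_right (0::real))"
    using eventually_at_right_less[of "0::real"] by eventually_elim (rule key)
  ultimately have "0 \<le> (z' - z) \<bullet> g + G * (\<gamma> * K\<^sup>2 + 0) + 0 * (K + (\<gamma> * K\<^sup>2 + 0))"
    by (rule tendsto_lowerbound) simp
  then show ?thesis by (simp add: G_def K_def algebra_simps)
qed

text \<open>A finite global coefficient rules out degenerate points, so the local coefficient is the
  least admissible parameter. It is itself admissible, and the condition is monotone in the
  parameter.\<close>

lemma curvature_condition_global:
  assumes N: "is_norm N" and z: "z \<in> Z" and fin: "global_concavity N Z \<noteq> \<infinity>"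
  shows "curvature_condition N Z z (global_concavity N Z)"
proof -
  have le: "local_concavity N Z z \<le> global_concavity N Z"
    unfolding global_concavity_def by (rule SUP_upper[OF z])
  then have "\<not> degenerate_point Z z"
    using fin by (auto simp: local_concavity_def top_unique)
  then have "curvature_condition N Z z (local_concavity N Z z)"
    using curvature_condition_Least[OF N z] by (simp add: local_concavity_def)
  then show ?thesis
    unfolding curvature_condition_def
    using le by (meson mult_right_mono order_trans zero_le)
qed

text \<open>Each minimizer is a competitor for the other: testing both first-order conditions this
  way and adding them leaves the gradient difference. The factor 2 in \<open>init\<close> becomes
  the half in the conclusion. \<open>S\<close> stands for the supremum in the initialization
  condition.\<close>

lemma gradient_difference_at_minimizers:
  fixes f1 f2 :: "'a::euclidean_space \<Rightarrow> real"
  assumes N: "is_norm N" and le: "\<And>v. norm v \<le> N v"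
    and min1: "is_arg_min f1 (\<lambda>u. u \<in> Z) z" and g1: "GDERIV f1 z :> g1"
    and min2: "is_arg_min f2 (\<lambda>u. u \<in> Z) w" and g2: "GDERIV f2 w :> g2"
    and init: "2 * global_concavity N Z * (ennreal (dual_norm N g1) + S) \<le> ennreal \<kappa>"
    and S: "ennreal (dual_norm N g2) \<le> S" and \<kappa>: "0 \<le> \<kappa>"
  shows "(w - z) \<bullet> (g2 - g1) \<le> \<kappa> / 2 * (norm (w - z))\<^sup>2"
proof -
  have z: "z \<in> Z" and w: "w \<in> Z"
    and m1: "\<And>u. u \<in> Z \<Longrightarrow> f1 z \<le> f1 u" and m2: "\<And>u. u \<in> Z \<Longrightarrow> f2 w \<le> f2 u"
    using min1 min2 by (auto simp: is_arg_min_linorder)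
  note dn = dual_norm_nonneg[OF N le]
  have init': "2 * global_concavity N Z * (ennreal (dual_norm N g1) + ennreal (dual_norm N g2)) \<le> ennreal \<kappa>"
    by (rule order_trans[OF _ init]) (intro mult_left_mono add_left_mono S, simp)
  show ?thesis
  proof (cases "global_concavity N Z")
    case (real \<gamma>)
    have curv: "curvature_condition N Z u (ennreal \<gamma>)" if "u \<in> Z" for u
      using curvature_condition_global[OF N that] real by simp
    have "ennreal (2 * \<gamma> * (dual_norm N g1 + dual_norm N g2)) \<le> ennreal \<kappa>"
      using init' real dn by (simp add: ennreal_mult ennreal_plus)
    then have "2 * \<gamma> * (dual_norm N g1 + dual_norm N g2) \<le> \<kappa>"
      using \<kappa> by (simp add: ennreal_le_iff)
    then have "2 * \<gamma> * (dual_norm N g1 + dual_norm N g2) * (norm (w - z))\<^sup>2 \<le> \<kappa> * (norm (w - z))\<^sup>2"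
      by (rule mult_right_mono) simp
    moreover have "0 \<le> (w - z) \<bullet> g1 + \<gamma> * dual_norm N g1 * (norm (w - z))\<^sup>2"
      by (rule first_order_curvature[OF N le m1 g1 curv[OF z]]) (use w real in auto)
    moreover have "0 \<le> (z - w) \<bullet> g2 + \<gamma> * dual_norm N g2 * (norm (z - w))\<^sup>2"
      by (rule first_order_curvature[OF N le m2 g2 curv[OF w]]) (use z real in auto)
    ultimately show ?thesis
      by (simp add: algebra_simps norm_minus_commute)
  next
    case top
    \<comment> \<open>Infinity times a nonzero sum would be infinite and exceed the finite
      right-hand side. So both dual norms are 0, hence both gradients, and the left-hand side of the
      goal is 0.\<close>
    then have "ennreal (dual_norm N g1) + ennreal (dual_norm N g2) = 0"
      using init' by (auto simp: ennreal_top_mult top_unique ennreal_mult_eq_top_iff split: if_splits)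
    then have "dual_norm N g1 = 0" "dual_norm N g2 = 0"
      using dn[of g1] dn[of g2] by (auto simp: ennreal_eq_0_iff)
    then have "g1 = 0" "g2 = 0" by (auto dest: dual_norm_eq_0D[OF N le])
    then show ?thesis using \<kappa> by simp
  qed
qed

section \<open>The contraction\<close>

text \<open>\<open>P\<close> and \<open>Q\<close> are the two cross terms, \<open>u\<close> and \<open>v\<close> the squared distances.\<close>

lemma divergence_contraction:
  fixes a b :: real
  assumes opt: "A2 + P \<le> (a' - m') / 2 * u"
    and rsc: "a' * u + a * v - E \<le> A2 + P + (B2 + Q)"
    and cross: "\<bar>P - Q\<bar> \<le> m' / 2 * u + m / 2 * v + E"
    and smooth: "B2 \<le> b * v + E"
    and "0 < a" "a \<le> b" "0 \<le> m'" "m \<le> a" "0 \<le> u" "0 \<le> v" "0 \<le> E"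
  shows "sqrt (max 0 A2) \<le> sqrt (1 - a / (2 * b)) * sqrt (max 0 B2) + sqrt (3 * E)"
proof -
  have b: "0 < b" using assms by linarith
  \<comment> \<open>Since \<open>r * b = a / 2\<close>, the smoothness bound scaled by
    \<open>r\<close> costs exactly the \<open>a / 2 * v\<close> that strong convexity leaves over;
    \<open>r \<le> 1 / 2\<close> limits its error to \<open>E / 2\<close>.\<close>
  define r where "r = a / (2 * b)"
  have r: "0 \<le> r" "r \<le> 1 / 2" using assms b by (auto simp: r_def field_simps)
  have "r * B2 \<le> r * (b * v + E)" by (rule mult_left_mono[OF smooth r(1)])
  also have "\<dots> = a / 2 * v + r * E" using b by (simp add: r_def field_simps)
  also have "\<dots> \<le> a / 2 * v + E / 2" using mult_right_mono[OF r(2), of E] assms by simp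
  finally have rB: "r * B2 \<le> a / 2 * v + E / 2" .
  \<comment> \<open>Write \<open>A2\<close> as \<open>(A2 + P) - P\<close> and trade
    \<open>-P\<close> for \<open>-Q\<close> by \<open>cross\<close>, then \<open>-Q\<close> for
    \<open>A2 + P + B2\<close> and the convexity terms by \<open>rsc\<close>. Now \<open>opt\<close>
    applies twice: \<open>u\<close> gets the coefficient
    \<open>(a' - m') - a' + m' / 2 = - m' / 2\<close>, and \<open>v\<close> gets
    \<open>- a + m / 2 \<le> - a / 2\<close>.\<close>
  have "m' * u \<ge> 0" "m * v \<le> a * v" using assms by (auto intro: mult_right_mono)
  then have "A2 \<le> B2 - a / 2 * v + 2 * E"
    using opt rsc cross by (simp add: algebra_simps abs_le_iff diff_divide_distrib add_divide_distrib)
  \<comment> \<open>The errors add up to \<open>5 / 2 * E\<close>, rounded up to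
    \<open>3 * E\<close>.\<close>
  with rB have "A2 \<le> (1 - r) * B2 + 3 * E" using assms by (simp add: algebra_simps)
  also have "\<dots> \<le> (1 - r) * max 0 B2 + 3 * E" using r by (intro add_right_mono mult_left_mono) auto
  finally have "max 0 A2 \<le> (1 - r) * max 0 B2 + 3 * E" using r assms by simp
  then have "sqrt (max 0 A2) \<le> sqrt ((1 - r) * max 0 B2 + 3 * E)" by simp
  also have "\<dots> \<le> sqrt ((1 - r) * max 0 B2) + sqrt (3 * E)"
    using r assms by (intro sqrt_add_le_add_sqrt) auto
  finally show ?thesis by (simp add: r_def real_sqrt_mult)
qed

text \<open>Composing the half steps gives an affine recursion for \<open>g\<close> with factor
  \<open>p * q\<close>. The value of \<open>f\<close> is half a round ahead and carries
  \<open>q * (p * q) ^ t\<close>, which is a full power divided by \<open>p\<close>.\<close>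

lemma alternating_recursion_bound:
  fixes p q s c :: real and f g :: "nat \<Rightarrow> real"
  assumes p: "0 < p" "p \<le> 1" and q: "0 \<le> q" "q \<le> 1" and pq: "p * q < 1" and s: "0 \<le> s"
    and f: "\<And>t. f (Suc t) \<le> q * g t + s" and g: "\<And>t. g (Suc t) \<le> p * f (Suc t) + s"
  shows "g t \<le> (p * q) ^ t * g 0 + 2 * s / (1 - p * q)"
    and "f (Suc t) \<le> (p * q) ^ Suc t / p * g 0 + 2 * s / (1 - p * q)"
proof -
  have step: "g (Suc t) \<le> p * q * g t + (1 + p) * s" for t
    using g[of t] mult_left_mono[OF f[of t] less_imp_le[OF p(1)]] by (simp add: algebra_simps)
  \<comment> \<open>The exact fixed point of the composed recursion is kept because one more half
    step turns it into \<open>(1 + q) * s / (1 - p * q)\<close>. Only then are \<open>1 + p\<close>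
    and \<open>1 + q\<close> rounded up to 2.\<close>
  have strong: "g t \<le> (p * q) ^ t * g 0 + (1 + p) * s / (1 - p * q)" for t
  proof (induction t)
    case 0
    then show ?case using p s pq by simp
  next
    case (Suc t)
    have "p * q * g t \<le> p * q * ((p * q) ^ t * g 0 + (1 + p) * s / (1 - p * q))"
      using Suc p q by (intro mult_left_mono) auto
    moreover have "p * q * ((1 + p) * s / (1 - p * q)) + (1 + p) * s = (1 + p) * s / (1 - p * q)"
      using pq by (simp add: field_simps)
    ultimately show ?case using step[of t] by (simp add: algebra_simps)
  qed
  have weaken: "(1 + a) * s / (1 - p * q) \<le> 2 * s / (1 - p * q)" if "a \<le> 1" for a
    using that s pq by (intro divide_right_mono mult_right_mono) auto
  show "g t \<le> (p * q) ^ t * g 0 + 2 * s / (1 - p * q)"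
    using strong[of t] weaken[OF p(2)] by linarith
  have "f (Suc t) \<le> q * ((p * q) ^ t * g 0 + (1 + p) * s / (1 - p * q)) + s"
    using f[of t] mult_left_mono[OF strong[of t] q(1)] by linarith
  also have "\<dots> = q * (p * q) ^ t * g 0 + (1 + q) * s / (1 - p * q)"
    using pq by (simp add: field_simps)
  also have "\<dots> \<le> q * (p * q) ^ t * g 0 + 2 * s / (1 - p * q)" using weaken[OF q(2)] by simp
  finally show "f (Suc t) \<le> (p * q) ^ Suc t / p * g 0 + 2 * s / (1 - p * q)"
    using p(1) by simp
qed

text \<open>The factor \<open>sqrt 6\<close> comes from
  \<open>(b + c)\<^sup>2 \<le> 2 * b\<^sup>2 + 2 * c\<^sup>2\<close>, which yields
  \<open>4 * a\<^sup>2\<close> from \<open>f\<close> and \<open>2 * a\<^sup>2\<close> from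
  \<open>g\<close>.\<close>

lemma distance_from_divergences:
  fixes a k m E :: real
  assumes m: "0 < m" and u: "m * u\<^sup>2 \<le> f\<^sup>2 + E" and v: "m * v\<^sup>2 \<le> g\<^sup>2 + E"
    and f: "0 \<le> f" "f \<le> sqrt 2 * a + k" and g: "0 \<le> g" "g \<le> a + k"
    and "0 \<le> a" "0 \<le> E"
  shows "sqrt (u\<^sup>2 + v\<^sup>2) \<le> (sqrt 6 * a + sqrt (4 * k\<^sup>2 + 2 * E)) / sqrt m"
proof -
  have sq: "(b + c)\<^sup>2 \<le> 2 * b\<^sup>2 + 2 * c\<^sup>2" for b c :: real
    using zero_le_power2[of "b - c"] by (simp add: power2_sum power2_diff)
  have "f\<^sup>2 \<le> (sqrt 2 * a + k)\<^sup>2" using f by (intro power_mono)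
  then have f2: "f\<^sup>2 \<le> 4 * a\<^sup>2 + 2 * k\<^sup>2"
    using sq[of "sqrt 2 * a" k] by (simp add: power_mult_distrib)
  have "g\<^sup>2 \<le> (a + k)\<^sup>2" using g by (intro power_mono)
  then have g2: "g\<^sup>2 \<le> 2 * a\<^sup>2 + 2 * k\<^sup>2" using sq[of a k] by simp
  have "m * (u\<^sup>2 + v\<^sup>2) \<le> 6 * a\<^sup>2 + (4 * k\<^sup>2 + 2 * E)"
    using u v f2 g2 by (simp add: algebra_simps)
  then have "sqrt (m * (u\<^sup>2 + v\<^sup>2)) \<le> sqrt (6 * a\<^sup>2 + (4 * k\<^sup>2 + 2 * E))" by simp
  also have "\<dots> \<le> sqrt (6 * a\<^sup>2) + sqrt (4 * k\<^sup>2 + 2 * E)"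
    using assms by (intro sqrt_add_le_add_sqrt) auto
  finally have "sqrt m * sqrt (u\<^sup>2 + v\<^sup>2) \<le> sqrt 6 * a + sqrt (4 * k\<^sup>2 + 2 * E)"
    using assms(8) by (simp only: real_sqrt_mult real_sqrt_abs abs_of_nonneg)
  then show ?thesis using m by (simp add: pos_le_divide_eq mult.commute)
qed

theorem theorem1:
  fixes L :: "(real ^ 'm) \<times> (real ^ 'n) \<Rightarrow> real"
    and X X0 :: "(real ^ 'm) set" and Y Y0 :: "(real ^ 'n) set"
    and Nx :: "real ^ 'm \<Rightarrow> real" and Ny :: "real ^ 'n \<Rightarrow> real"
    and x :: "nat \<Rightarrow> real ^ 'm" and y :: "nat \<Rightarrow> real ^ 'n"
    and xh :: "real ^ 'm" and yh :: "real ^ 'n"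
    and xmin :: "real ^ 'n \<Rightarrow> real ^ 'm" and ymin :: "real ^ 'm \<Rightarrow> real ^ 'n"
    and \<rho>x \<rho>y \<alpha>x \<alpha>y \<beta>x \<beta>y \<mu>x \<mu>y \<epsilon>x \<epsilon>y C :: real
  assumes "\<And>z. L differentiable (at z)"
    and "is_norm Nx" and "\<And>v. Nx v \<ge> norm v"
    and "is_norm Ny" and "\<And>v. Ny v \<ge> norm v"
    and "closed X" and "closed Y"
    and "x 0 \<in> X" and "y 0 \<in> Y"
    and "\<rho>x > 0" and "\<rho>y > 0"
    and "X0 = X \<inter> cball (x 0) \<rho>x" and "Y0 = Y \<inter> cball (y 0) \<rho>y"
    and "is_arg_min L (\<lambda>z. z \<in> X0 \<times> Y0) (xh, yh)"
    and "\<And>v. v \<in> Y0 \<Longrightarrow> is_arg_min (\<lambda>u. L (u, v)) (\<lambda>u. u \<in> X0) (xmin v)"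
    and "\<And>u. u \<in> X0 \<Longrightarrow> is_arg_min (\<lambda>v. L (u, v)) (\<lambda>v. v \<in> Y0) (ymin u)"
    and "0 < \<alpha>x" and "\<alpha>x \<le> \<beta>x" and "0 < \<alpha>y" and "\<alpha>y \<le> \<beta>y"
    and "0 \<le> \<mu>x" and "\<mu>x \<le> \<alpha>x" and "0 \<le> \<mu>y" and "\<mu>y \<le> \<alpha>y"
    and "\<epsilon>x \<ge> 0" and "\<epsilon>y \<ge> 0"
    and "joint_RSC L X0 Y0 xh yh \<alpha>x \<alpha>y \<epsilon>x \<epsilon>y"
    and "restricted_smoothness L X0 Y0 xh yh \<alpha>x \<alpha>y \<beta>x \<beta>y \<epsilon>x \<epsilon>y"
    and "cross_product_bound L X0 Y0 xh yh \<alpha>x \<alpha>y \<mu>x \<mu>y \<epsilon>x \<epsilon>y"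
    and "initialization_condition L Nx Ny X0 Y0 xh yh xmin ymin \<alpha>x \<alpha>y \<mu>x \<mu>y"
    and "\<And>t. t \<ge> 1 \<Longrightarrow> x t = xmin (y (t - 1))"
    and "\<And>t. t \<ge> 1 \<Longrightarrow> y t = ymin (x t)"
    and "C = 18 / (1 - sqrt (1 - \<alpha>x / (2 * \<beta>x)) * sqrt (1 - \<alpha>y / (2 * \<beta>y)))
             * sqrt (max \<alpha>x \<alpha>y / min \<alpha>x \<alpha>y)"
  shows "\<forall>t\<ge>1.
      D_x L xh yh (x t) \<le> sqrt (1 - \<alpha>y / (2 * \<beta>y)) * D_y L xh yh (y (t - 1))
                           + sqrt (3 * (\<alpha>x * \<epsilon>x\<^sup>2 + \<alpha>y * \<epsilon>y\<^sup>2)) \<and>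
      D_y L xh yh (y t) \<le> sqrt (1 - \<alpha>x / (2 * \<beta>x)) * D_x L xh yh (x t)
                           + sqrt (3 * (\<alpha>x * \<epsilon>x\<^sup>2 + \<alpha>y * \<epsilon>y\<^sup>2)) \<and>
      norm ((x t, y t) - (xh, yh))
        \<le> (sqrt (1 - \<alpha>x / (2 * \<beta>x)) * sqrt (1 - \<alpha>y / (2 * \<beta>y))) ^ t
              * (sqrt (6 * \<beta>y) * \<rho>y / sqrt (min \<alpha>x \<alpha>y))
            + C * max \<epsilon>x \<epsilon>y"
proof -

  \<comment> \<open>The assumptions in pointwise form\<close>
  define p where "p = sqrt (1 - \<alpha>x / (2 * \<beta>x))"
  define q where "q = sqrt (1 - \<alpha>y / (2 * \<beta>y))"
  define E where "E = \<alpha>x * \<epsilon>x\<^sup>2 + \<alpha>y * \<epsilon>y\<^sup>2"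
  define s where "s = sqrt (3 * E)"
  define m where "m = min \<alpha>x \<alpha>y"
  define M where "M = max \<alpha>x \<alpha>y"
  define e where "e = max \<epsilon>x \<epsilon>y"
  note defs = p_def q_def s_def E_def
  have \<beta>: "0 < \<beta>x" "0 < \<beta>y" using assms(17-20) by linarith+
  have m: "0 < m" and M: "0 < M" using assms(17,19) by (auto simp: m_def M_def)
  have Ex: "0 \<le> \<alpha>x * \<epsilon>x\<^sup>2" and Ey: "0 \<le> \<alpha>y * \<epsilon>y\<^sup>2" using assms(17,19) by auto
  then have E: "0 \<le> E" by (simp add: E_def)
  have xh: "xh \<in> X0" and yh: "yh \<in> Y0"
    using assms(14) by (auto simp: is_arg_min_def)
  have min_xh: "is_arg_min (\<lambda>u. L (u, yh)) (\<lambda>u. u \<in> X0) xh"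
    and min_yh: "is_arg_min (\<lambda>v. L (xh, v)) (\<lambda>v. v \<in> Y0) yh"
    using assms(14) by (auto simp: is_arg_min_linorder)
  have xmin: "xmin v \<in> X0" if "v \<in> Y0" for v using assms(15)[OF that] by (simp add: is_arg_min_def)
  have ymin: "ymin u \<in> Y0" if "u \<in> X0" for u using assms(16)[OF that] by (simp add: is_arg_min_def)
  have init_x: "2 * global_concavity Nx X0 *
       (ennreal (dual_norm Nx (gradient_x L xh yh))
        + (SUP y\<in>Y0. ennreal (dual_norm Nx (gradient_x L (xmin y) y)))) \<le> ennreal (\<alpha>x - \<mu>x)"
    and init_y: "2 * global_concavity Ny Y0 *
       (ennreal (dual_norm Ny (gradient_y L xh yh))
        + (SUP x\<in>X0. ennreal (dual_norm Ny (gradient_y L x (ymin x))))) \<le> ennreal (\<alpha>y - \<mu>y)"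
    using assms(30) by (auto simp: initialization_condition_def)
  have rsc: "\<alpha>x * (norm (u - xh))\<^sup>2 + \<alpha>y * (norm (v - yh))\<^sup>2 - E
      \<le> (u - xh) \<bullet> (gradient_x L u v - gradient_x L xh yh)
        + (v - yh) \<bullet> (gradient_y L u v - gradient_y L xh yh)" if "u \<in> X0" "v \<in> Y0" for u v
    using assms(27) that unfolding joint_RSC_def E_def gradient_Pair[OF assms(1)] by fastforce
  have smooth: "D2_x L xh yh u \<le> \<beta>x * (norm (u - xh))\<^sup>2 + E"
      "D2_y L xh yh v \<le> \<beta>y * (norm (v - yh))\<^sup>2 + E" if "u \<in> X0" "v \<in> Y0" for u v
    using assms(28) that Ex Ey unfolding restricted_smoothness_def E_def by fastforce+
  have cross: "\<bar>(u - xh) \<bullet> (gradient_x L u v - gradient_x L u yh)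
          - (v - yh) \<bullet> (gradient_y L u v - gradient_y L xh v)\<bar>
        \<le> \<mu>x / 2 * (norm (u - xh))\<^sup>2 + \<mu>y / 2 * (norm (v - yh))\<^sup>2 + E"
    if "u \<in> X0" "v \<in> Y0" for u v
    using assms(29) that unfolding cross_product_bound_def E_def by (simp add: add.assoc)
  \<comment> \<open>The intermediate points \<open>(u, yh)\<close> here and \<open>(xh, v)\<close>
    below are chosen so that the remainders are the two terms compared in
    \<open>cross\<close>.\<close>
  have split_x: "(u - xh) \<bullet> (gradient_x L u v - gradient_x L xh yh)
      = D2_x L xh yh u + (u - xh) \<bullet> (gradient_x L u v - gradient_x L u yh)" for u v
    by (simp add: D2_x_def inner_diff_right)
  have split_y: "(v - yh) \<bullet> (gradient_y L u v - gradient_y L xh yh)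
      = D2_y L xh yh v + (v - yh) \<bullet> (gradient_y L u v - gradient_y L xh v)" for u v
    by (simp add: D2_y_def inner_diff_right)

  \<comment> \<open>Contraction of the divergence in each half step\<close>
  have step_x: "D_x L xh yh (xmin v) \<le> q * D_y L xh yh v + s" if v: "v \<in> Y0" for v
  proof -
    note u = xmin[OF v]
    have "(xmin v - xh) \<bullet> (gradient_x L (xmin v) v - gradient_x L xh yh)
        \<le> (\<alpha>x - \<mu>x) / 2 * (norm (xmin v - xh))\<^sup>2"
      \<comment> \<open>The gradient at \<open>(xmin v, v)\<close> is one of those in the supremum
        of \<open>init_x\<close>, as the algorithm and the condition share the selection
        \<open>xmin\<close>.\<close>
      by (rule gradient_difference_at_minimizers[OF assms(2,3) min_xh _ assms(15)[OF v] _ init_x])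
        (use assms(22) in \<open>auto intro!: GDERIV_gradient_x assms(1) SUP_upper v\<close>)
    \<comment> \<open>The update of \<open>x\<close> contracts at the rate of \<open>y\<close>: the
      negative term that smoothness exploits is the squared distance of the block held
      fixed.\<close>
    then show ?thesis
      unfolding D_x_def D_y_def defs split_x
      by (rule divergence_contraction[OF _ rsc[OF u v, unfolded split_x split_y E_def]
          cross[OF u v, unfolded E_def] smooth(2)[OF u v, unfolded E_def]])
        (use assms(17-26) E in \<open>auto simp: E_def\<close>)
  qed
  have step_y: "D_y L xh yh (ymin u) \<le> p * D_x L xh yh u + s" if u: "u \<in> X0" for u
  proof -
    note v = ymin[OF u]
    have opt: "(ymin u - yh) \<bullet> (gradient_y L u (ymin u) - gradient_y L xh yh)
        \<le> (\<alpha>y - \<mu>y) / 2 * (norm (ymin u - yh))\<^sup>2"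
      by (rule gradient_difference_at_minimizers[OF assms(4,5) min_yh _ assms(16)[OF u] _ init_y])
        (use assms(24) in \<open>auto intro!: GDERIV_gradient_y assms(1) SUP_upper u\<close>)
    show ?thesis
      unfolding D_x_def D_y_def defs
      by (rule divergence_contraction[OF opt[unfolded split_y] _ _ smooth(1)[OF u v, unfolded E_def]])
        (use rsc[OF u v, unfolded split_x split_y] cross[OF u v] assms(17-26) E
          in \<open>auto simp: E_def abs_minus_commute add_ac\<close>)
  qed

  \<comment> \<open>Feasibility of the iterates and their recursions\<close>
  have Y: "y t \<in> Y0" for t
  proof (induction t)
    case 0
    show ?case using assms(9,11,13) by simp
  next
    case (Suc t)
    then show ?case using assms(31)[of "Suc t"] assms(32)[of "Suc t"] by (simp add: xmin ymin)
  qed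
  have x_Suc: "x (Suc t) = xmin (y t)" and y_Suc: "y (Suc t) = ymin (x (Suc t))" for t
    using assms(31)[of "Suc t"] assms(32)[of "Suc t"] by auto
  have X: "x (Suc t) \<in> X0" for t unfolding x_Suc by (rule xmin[OF Y])
  have rec_x: "D_x L xh yh (x (Suc t)) \<le> q * D_y L xh yh (y t) + s" for t
    unfolding x_Suc by (rule step_x[OF Y])
  have rec_y: "D_y L xh yh (y (Suc t)) \<le> p * D_x L xh yh (x (Suc t)) + s" for t
    unfolding y_Suc by (rule step_y[OF X])

  \<comment> \<open>Bounds on the rate, the noise and the initial divergence\<close>
  have "1 / 2 \<le> 1 - \<alpha>x / (2 * \<beta>x)" "1 - \<alpha>x / (2 * \<beta>x) < 1"
    using assms(17,18) \<beta> by (auto simp: field_simps)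
  \<comment> \<open>The upper bound makes the rate \<open>p * q\<close> strictly less than 1; the
    lower one gives \<open>1 / p \<le> sqrt 2\<close>, the price of the half-round shift in the
    bound for \<open>x\<close>.\<close>
  then have p2: "sqrt (1 / 2) \<le> p" and p1: "p < 1" unfolding p_def by (auto simp del: real_sqrt_divide)
  have p: "0 < p" "p \<le> 1" using p2 p1 real_sqrt_gt_zero[of "1/2"] by linarith+
  have ip: "1 / p \<le> sqrt 2" using p2 p by (simp add: real_sqrt_divide field_simps)
  have q: "0 \<le> q" "q \<le> 1" unfolding q_def using assms(19,20) \<beta> by (auto simp: field_simps)
  define r where "r = p * q"
  have r0: "0 \<le> r" using p q by (simp add: r_def)
  have "r \<le> p" using p q unfolding r_def by (intro mult_left_le) auto
  with p1 have "r < 1" by linarith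
  note r = r0 this
  have s: "0 \<le> s" "s \<le> 1.74 * sqrt E"
  proof -
    have "sqrt 3 \<le> (1.74 :: real)" by (rule real_le_lsqrt) (auto simp: power2_eq_square)
    then have "sqrt 3 * sqrt E \<le> 1.74 * sqrt E" using E by (intro mult_right_mono) auto
    then show "s \<le> 1.74 * sqrt E" by (simp only: s_def real_sqrt_mult)
    show "0 \<le> s" using E by (simp add: s_def)
  qed
  define d where "d = D_y L xh yh (y 0)"
  \<comment> \<open>The point \<open>yh\<close> lies in the ball of radius \<open>\<rho>y\<close>
    about \<open>y 0\<close>, so smoothness bounds the initial divergence.\<close>
  have "max 0 (D2_y L xh yh (y 0)) \<le> \<beta>y * \<rho>y\<^sup>2 + E"
  proof -
    have "norm (y 0 - yh) \<le> \<rho>y" using yh assms(13) by (simp add: dist_norm)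
    then have "\<beta>y * (norm (y 0 - yh))\<^sup>2 \<le> \<beta>y * \<rho>y\<^sup>2"
      using \<beta> by (intro mult_left_mono power_mono) auto
    with smooth(2)[OF xh Y[of 0]] have "D2_y L xh yh (y 0) \<le> \<beta>y * \<rho>y\<^sup>2 + E" by linarith
    then show ?thesis using E \<beta> by simp
  qed
  then have "d \<le> sqrt (\<beta>y * \<rho>y\<^sup>2 + E)" by (simp add: d_def D_y_def)
  also have "\<dots> \<le> sqrt (\<beta>y * \<rho>y\<^sup>2) + sqrt E" using \<beta> E by (intro sqrt_add_le_add_sqrt) auto
  finally have d: "d \<le> sqrt \<beta>y * \<rho>y + sqrt E" using assms(11) by (simp add: real_sqrt_mult)

  \<comment> \<open>Distance to the minimizer after each round\<close>
  have bound: "norm ((x (Suc t), y (Suc t)) - (xh, yh))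
        \<le> r ^ Suc t * (sqrt (6 * \<beta>y) * \<rho>y / sqrt m) + C * e" for t
  proof -
    define R where "R = r ^ Suc t"
    define a where "a = R * (sqrt \<beta>y * \<rho>y)"
    define T where "T = sqrt E / (1 - r)"
    \<comment> \<open>In units of \<open>T\<close>, the accumulated noise is at most 3.48, twice
      1.74. The term \<open>sqrt E\<close> in the bound on \<open>d\<close> adds at most 1 for
      \<open>y\<close> and \<open>sqrt 2 \<le> 1.5\<close> for \<open>x\<close>, so the totals 4.48
      and 4.98 stay below 5.\<close>
    define k where "k = 5 * T"
    have T: "0 \<le> T" using r E by (simp add: T_def)
    have R: "0 \<le> R" "R \<le> 1" using r unfolding R_def by (auto intro!: power_le_one simp del: power_Suc)
    have a: "0 \<le> a" using R \<beta> assms(11) by (simp add: a_def)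
    have "2 * s / (1 - r) \<le> 3.48 * sqrt E / (1 - r)"
      using s r by (intro divide_right_mono) auto
    then have s': "2 * s / (1 - r) \<le> 3.48 * T" by (simp only: T_def times_divide_eq_right)
    have E': "sqrt E \<le> T" using r E by (simp add: T_def field_simps)
    have Rd: "R * d \<le> a + R * sqrt E"
      using mult_left_mono[OF d R(1)] by (simp add: a_def algebra_simps)
    have RE: "R * sqrt E \<le> T"
      using mult_right_mono[OF R(2), of "sqrt E"] E E' by simp
    note rec = alternating_recursion_bound[where f = "\<lambda>t. D_x L xh yh (x t)"
        and g = "\<lambda>t. D_y L xh yh (y t)", OF p q r(2)[unfolded r_def] s(1) rec_x rec_y,
        folded r_def d_def]
    have "D_y L xh yh (y (Suc t)) \<le> R * d + 2 * s / (1 - r)"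
      using rec(1)[of "Suc t"] by (simp only: R_def)
    also have "\<dots> \<le> a + (T + 3.48 * T)"
      using Rd RE s' by linarith
    also have "\<dots> \<le> a + k"
      using T by (simp add: k_def)
    finally have gk: "D_y L xh yh (y (Suc t)) \<le> a + k" .
    have d0: "0 \<le> d" by (simp add: d_def D_y_def)
    have "D_x L xh yh (x (Suc t)) \<le> 1 / p * (R * d) + 2 * s / (1 - r)"
      using rec(2)[of t] by (simp add: R_def)
    also have "1 / p * (R * d) \<le> sqrt 2 * (R * d)"
      using ip R d0 by (intro mult_right_mono) auto
    also have "sqrt 2 * (R * d) \<le> sqrt 2 * (a + T)"
      using Rd RE by (intro mult_left_mono) auto
    also have "\<dots> \<le> sqrt 2 * a + 1.5 * T"
    proof -
      have "sqrt 2 \<le> (1.5 :: real)" by (rule real_le_lsqrt) (auto simp: power2_eq_square)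
      then have "sqrt 2 * T \<le> 1.5 * T"
        using T by (intro mult_right_mono) auto
      then show ?thesis by (simp add: distrib_left)
    qed
    also have "2 * s / (1 - r) \<le> 3.48 * T" by (rule s')
    also have "sqrt 2 * a + 1.5 * T + 3.48 * T \<le> sqrt 2 * a + k"
      using T by (simp add: k_def)
    finally have fk: "D_x L xh yh (x (Suc t)) \<le> sqrt 2 * a + k" by simp
    have ux: "m * (norm (x (Suc t) - xh))\<^sup>2 \<le> (D_x L xh yh (x (Suc t)))\<^sup>2 + E"
    proof -
      have "m * (norm (x (Suc t) - xh))\<^sup>2 \<le> \<alpha>x * (norm (x (Suc t) - xh))\<^sup>2"
        by (intro mult_right_mono) (auto simp: m_def)
      \<comment> \<open>At \<open>v = yh\<close> joint strong convexity loses its \<open>y\<close>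
        part and the gradient difference is exactly \<open>D2_x\<close>.\<close>
      also have "\<dots> \<le> D2_x L xh yh (x (Suc t)) + E"
        using rsc[OF X yh, of t] by (simp add: D2_x_def)
      finally show ?thesis by (simp add: D_x_def)
    qed
    have uy: "m * (norm (y (Suc t) - yh))\<^sup>2 \<le> (D_y L xh yh (y (Suc t)))\<^sup>2 + E"
    proof -
      have "m * (norm (y (Suc t) - yh))\<^sup>2 \<le> \<alpha>y * (norm (y (Suc t) - yh))\<^sup>2"
        by (intro mult_right_mono) (auto simp: m_def)
      also have "\<dots> \<le> D2_y L xh yh (y (Suc t)) + E"
        using rsc[OF xh Y, of "Suc t"] by (simp add: D2_y_def)
      finally show ?thesis by (simp add: D_y_def)
    qed
    have "norm ((x (Suc t), y (Suc t)) - (xh, yh))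
        \<le> (sqrt 6 * a + sqrt (4 * k\<^sup>2 + 2 * E)) / sqrt m"
      unfolding diff_Pair norm_Pair
      by (rule distance_from_divergences[OF m ux uy _ fk _ gk a E]) (auto simp: D_x_def D_y_def)
    also have "\<dots> \<le> (sqrt 6 * a + 18 / (1 - r) * (sqrt M * e)) / sqrt m"
    proof -
      have e0: "0 \<le> e" using assms(25) by (simp add: e_def)
      have "\<alpha>x * \<epsilon>x\<^sup>2 \<le> M * e\<^sup>2" "\<alpha>y * \<epsilon>y\<^sup>2 \<le> M * e\<^sup>2"
        using assms(17,19,25,26) by (auto simp: M_def e_def intro!: mult_mono power_mono)
      then have EM: "E \<le> 2 * (M * e\<^sup>2)" by (simp add: E_def)
      have "(1 - r)\<^sup>2 \<le> 1" using r by (intro power_le_one) auto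
      then have "E * (1 - r)\<^sup>2 \<le> E" using E by (intro mult_left_le) auto
      then have "E \<le> E / (1 - r)\<^sup>2" using r by (simp add: field_simps)
      moreover have "k\<^sup>2 = 25 * (E / (1 - r)\<^sup>2)"
        using E by (simp add: k_def T_def power_divide power_mult_distrib)
      \<comment> \<open>Here 102 is \<open>4 * 25 + 2\<close>. The bound
        \<open>E \<le> 2 * (M * e\<^sup>2)\<close> doubles it to 204, which is below 324, the square
        of the 18 in \<open>C\<close>.\<close>
      ultimately have "4 * k\<^sup>2 + 2 * E \<le> 102 * (E / (1 - r)\<^sup>2)" by linarith
      also have "\<dots> \<le> 102 * (2 * (M * e\<^sup>2) / (1 - r)\<^sup>2)"
        using EM by (intro mult_left_mono divide_right_mono) auto
      also have "\<dots> \<le> 324 * (M * e\<^sup>2) / (1 - r)\<^sup>2"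
        using M by (simp add: divide_right_mono)
      also have "\<dots> = (18 / (1 - r) * (sqrt M * e))\<^sup>2"
        using M by (simp add: power_divide power_mult_distrib)
      finally have "sqrt (4 * k\<^sup>2 + 2 * E) \<le> 18 / (1 - r) * (sqrt M * e)"
        using r M e0 by (intro real_le_lsqrt) auto
      then show ?thesis using m by (intro divide_right_mono) auto
    qed
    also have "\<dots> = r ^ Suc t * (sqrt (6 * \<beta>y) * \<rho>y / sqrt m) + C * e"
    proof -
      have "C = 18 / (1 - r) * (sqrt M / sqrt m)"
        by (simp add: assms(33) r_def p_def q_def M_def m_def real_sqrt_divide)
      then show ?thesis
        by (simp add: a_def R_def real_sqrt_mult add_divide_distrib mult_ac)
    qed
    finally show ?thesis .
  qed
  show ?thesis
  proof (intro allI impI)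
    fix t :: nat assume "1 \<le> t"
    then obtain t' where t: "t = Suc t'" by (cases t) auto
    show "D_x L xh yh (x t) \<le> sqrt (1 - \<alpha>y / (2 * \<beta>y)) * D_y L xh yh (y (t - 1))
                           + sqrt (3 * (\<alpha>x * \<epsilon>x\<^sup>2 + \<alpha>y * \<epsilon>y\<^sup>2)) \<and>
      D_y L xh yh (y t) \<le> sqrt (1 - \<alpha>x / (2 * \<beta>x)) * D_x L xh yh (x t)
                           + sqrt (3 * (\<alpha>x * \<epsilon>x\<^sup>2 + \<alpha>y * \<epsilon>y\<^sup>2)) \<and>
      norm ((x t, y t) - (xh, yh))
        \<le> (sqrt (1 - \<alpha>x / (2 * \<beta>x)) * sqrt (1 - \<alpha>y / (2 * \<beta>y))) ^ t
              * (sqrt (6 * \<beta>y) * \<rho>y / sqrt (min \<alpha>x \<alpha>y))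
            + C * max \<epsilon>x \<epsilon>y"
      using rec_x[of t'] rec_y[of t'] bound[of t']
      unfolding t r_def m_def e_def defs by simp
  qed
qed

end
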